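(* Let $B$ be a real Banach space and let $C$ be a nonempty subset of $B$. Let $x\in B$, $jx\in J(x)$ and $z\in C$. If there is $jz\in J(z)$ such that $$\langle jx-jz,z-y\rangle\ge 0\quad\text{for all } y\in C,$$ then $z\in\pi_C(jx)\subset\Pi_C(x)$.
   Context: $B^*$ is the dual of $B$ and $\langle\cdot,\cdot\rangle$ is the pairing between $B^*$ and $B$. The normalized duality map is $J(x)=\{\psi\in B^*:\langle\psi,x\rangle=\|\psi\|\|x\|=\|x\|^2=\|\psi\|^2\}$ for $x\in B$. $V(\phi,x)=\|\phi\|^2-2\langle\phi,x\rangle+\|x\|^2$ for $\phi\in B^*$, $x\in B$. The generalized projection is $\pi_C(\phi)=\{u\in C: V(\phi,u)=\inf_{y\in C}V(\phi,y)\}$ for $\phi\in B^*$ (possibly empty), and the generalized metric projection $\Pi_C:B\to 2^C$ is $\Pi_C(x)=\bigcup_{jx\in J(x)}\pi_C(jx)$. *)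

theory Defs
  imports "HOL-Analysis.Analysis"
begin

text \<open>The dual of a real normed space \<open>'a\<close> is the type \<open>'a \<Rightarrow>\<^sub>L real\<close> of bounded linear
  functionals with the operator norm; the pairing of \<open>\<phi>\<close> and \<open>x\<close> is \<^const>\<open>blinfun_apply\<close> \<open>\<phi> x\<close>.\<close>

definition duality_map :: "'a::real_normed_vector \<Rightarrow> ('a \<Rightarrow>\<^sub>L real) set" where
  "duality_map x = {\<psi>. blinfun_apply \<psi> x = norm \<psi> * norm x \<and>
                       norm \<psi> * norm x = (norm x)\<^sup>2 \<and> (norm x)\<^sup>2 = (norm \<psi>)\<^sup>2}"

definition lyapunov :: "('a::real_normed_vector \<Rightarrow>\<^sub>L real) \<Rightarrow> 'a \<Rightarrow> real" where
  "lyapunov \<phi> x = (norm \<phi>)\<^sup>2 - 2 * blinfun_apply \<phi> x + (norm x)\<^sup>2"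

text \<open>The real infimum below is the genuine one whenever \<open>C\<close> is nonempty, because
  \<open>lyapunov \<phi> y \<ge> (norm \<phi> - norm y)\<^sup>2 \<ge> 0\<close>; for empty \<open>C\<close> the projection is empty.\<close>

definition gen_proj :: "'a::real_normed_vector set \<Rightarrow> ('a \<Rightarrow>\<^sub>L real) \<Rightarrow> 'a set" where
  "gen_proj C \<phi> = {u \<in> C. lyapunov \<phi> u = (INF y\<in>C. lyapunov \<phi> y)}"

definition gen_metric_proj :: "'a::real_normed_vector set \<Rightarrow> 'a \<Rightarrow> 'a set" where
  "gen_metric_proj C x = (\<Union>\<psi>\<in>duality_map x. gen_proj C \<psi>)"

end

theory Submission
  imports Defs
begin

text \<open>For \<open>\<psi>\<close> in \<open>duality_map z\<close>, moving from \<open>z\<close>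
  to \<open>y\<close> changes \<open>lyapunov \<phi>\<close> by twice the pairing assumed
  nonnegative plus terms that are nonnegative because \<open>\<psi>\<close> has norm
  \<open>norm z\<close> and attains it at \<open>z\<close>. So \<open>z\<close> minimizes
  \<open>lyapunov jx\<close> over \<open>C\<close>. The inclusion holds because \<open>jx\<close> is
  one of the indices of the union.\<close>

lemma lyapunov_le_if_duality_map:
  fixes \<phi> \<psi> :: "'a::real_normed_vector \<Rightarrow>\<^sub>L real"
  assumes \<psi>: "\<psi> \<in> duality_map z" and ge: "blinfun_apply (\<phi> - \<psi>) (z - y) \<ge> 0"
  shows "lyapunov \<phi> z \<le> lyapunov \<phi> y"
proof -
  have nrm: "norm \<psi> = norm z" and pz: "blinfun_apply \<psi> z = (norm z)\<^sup>2"
    using \<psi> by (auto simp: duality_map_def)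
  have py: "blinfun_apply \<psi> y \<le> norm z * norm y"
    using norm_blinfun[of \<psi> y] by (simp add: nrm)
  \<comment> \<open>Completing the square: the term \<open>2 * norm z * norm y\<close> is added and
    subtracted, leaving a square and the defect in \<open>py\<close>.\<close>
  have "lyapunov \<phi> y - lyapunov \<phi> z = 2 * blinfun_apply (\<phi> - \<psi>) (z - y)
      + (norm z - norm y)\<^sup>2 + 2 * (norm z * norm y - blinfun_apply \<psi> y)"
    by (simp add: lyapunov_def blinfun.diff_left blinfun.diff_right pz power2_diff)
  also have "\<dots> \<ge> 0"
    using ge py by simp
  finally show ?thesis by simp
qed

theorem theorem3p12:
  fixes C :: "'a::banach set" and x z :: 'a and jx :: "'a \<Rightarrow>\<^sub>L real"
  assumes "C \<noteq> {}"
    and "jx \<in> duality_map x"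
    and "z \<in> C"
    and "\<exists>jz\<in>duality_map z. \<forall>y\<in>C. blinfun_apply (jx - jz) (z - y) \<ge> 0"
  shows "z \<in> gen_proj C jx \<and> gen_proj C jx \<subseteq> gen_metric_proj C x"
proof
  have "lyapunov jx z \<le> lyapunov jx y" if "y \<in> C" for y
    using assms(4) that lyapunov_le_if_duality_map by blast
  \<comment> \<open>The value at \<open>z\<close> is a lower bound that is attained, so the real
    infimum is a genuine minimum.\<close>
  then have "(INF y\<in>C. lyapunov jx y) = lyapunov jx z"
    using assms(3) by (intro cInf_eq_minimum) auto
  then show "z \<in> gen_proj C jx"
    using assms(3) by (simp add: gen_proj_def)
  show "gen_proj C jx \<subseteq> gen_metric_proj C x"
    using assms(2) by (auto simp: gen_metric_proj_def)
qed

end
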